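(* Fix a real number $r>0$. Let $R=\{(x,y)\mid |x|=|y|=n,\ K(x)\geq n,\ K(y)\geq n\}$ and $I=\{(x,y)\in R\mid K(x\mid y)\geq r n \ \text{or}\ K(y\mid x)\geq r n\}$, where $n=|x|=|y|$. Then $I$ is immune conditional to $R$: there is no computably enumerable set $A$ of pairs of binary strings such that $A\cap R$ is infinite and $A\cap R\subseteq I$.
   Context: Fix a universal prefix-free machine $U$. $K$ denotes prefix-free Kolmogorov complexity and $K(x\mid y)$ conditional prefix-free complexity. Pairs of binary strings are identified with natural numbers via a fixed computable coding. Definition: a set $Y$ is immune conditional to a set $X$ if there is no c.e. set $A$ with $A\cap X$ infinite and $A\cap X\subseteq Y$. *)

theory Defs
  imports Complex_Main "HOL-Library.Nat_Bijection"
begin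

datatype recf =
    Zr
  | Sc
  | Prj nat
  | Cn recf "recf list"
  | Pr recf recf
  | Mn recf

inductive eval :: "recf \<Rightarrow> nat list \<Rightarrow> nat \<Rightarrow> bool" where
  eval_Zr: "eval Zr xs 0"
| eval_Sc: "eval Sc (x # xs) (Suc x)"
| eval_Prj: "i < length xs \<Longrightarrow> eval (Prj i) xs (xs ! i)"
| eval_Cn: "length ys = length gs \<Longrightarrow> (\<forall>i<length gs. eval (gs ! i) xs (ys ! i))
            \<Longrightarrow> eval f ys z \<Longrightarrow> eval (Cn f gs) xs z"
| eval_Pr0: "eval f xs y \<Longrightarrow> eval (Pr f g) (0 # xs) y"
| eval_PrS: "eval (Pr f g) (n # xs) y \<Longrightarrow> eval g (n # y # xs) z
            \<Longrightarrow> eval (Pr f g) (Suc n # xs) z"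
| eval_Mn: "eval f (n # xs) 0 \<Longrightarrow> (\<forall>m<n. \<exists>y. eval f (m # xs) y \<and> y \<noteq> 0)
            \<Longrightarrow> eval (Mn f) xs n"

text \<open>Bijective binary coding of bool lists (binary strings) as naturals.\<close>
fun str_code :: "bool list \<Rightarrow> nat" where
  "str_code [] = 0"
| "str_code (b # xs) = 2 * str_code xs + (if b then 2 else 1)"

definition pair_code :: "bool list \<times> bool list \<Rightarrow> nat" where
  "pair_code xy = prod_encode (str_code (fst xy), str_code (snd xy))"

definition ce :: "nat set \<Rightarrow> bool" where
  "ce A \<longleftrightarrow> (\<exists>f. \<forall>x. x \<in> A \<longleftrightarrow> (\<exists>y. eval f [x] y))"

definition ce_pairs :: "(bool list \<times> bool list) set \<Rightarrow> bool" where
  "ce_pairs A \<longleftrightarrow> ce (pair_code ` A)"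

text \<open>A (conditional) machine: maps program p and condition y to an optional
  output; it is partial computable if some partial recursive function
  computes it on codes.\<close>
definition partial_computable2 ::
  "(bool list \<Rightarrow> bool list \<Rightarrow> bool list option) \<Rightarrow> bool" where
  "partial_computable2 M \<longleftrightarrow>
     (\<exists>f. \<forall>p y z. eval f [str_code p, str_code y] z \<longleftrightarrow>
                    (\<exists>w. M p y = Some w \<and> z = str_code w))"

definition prefix_free :: "bool list set \<Rightarrow> bool" where
  "prefix_free D \<longleftrightarrow> (\<forall>p\<in>D. \<forall>q\<in>D. (\<exists>s. q = p @ s) \<longrightarrow> p = q)"

definition pf_machine :: "(bool list \<Rightarrow> bool list \<Rightarrow> bool list option) \<Rightarrow> bool" where
  "pf_machine M \<longleftrightarrow> partial_computable2 M \<and>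
     (\<forall>y. prefix_free {p. M p y \<noteq> None})"

definition universal_pf :: "(bool list \<Rightarrow> bool list \<Rightarrow> bool list option) \<Rightarrow> bool" where
  "universal_pf U \<longleftrightarrow> pf_machine U \<and>
     (\<forall>M. pf_machine M \<longrightarrow> (\<exists>\<rho>. \<forall>p y. U (\<rho> @ p) y = M p y))"

definition Kc :: "(bool list \<Rightarrow> bool list \<Rightarrow> bool list option) \<Rightarrow> bool list \<Rightarrow> bool list \<Rightarrow> nat" where
  "Kc U x y = (LEAST k. \<exists>p. length p = k \<and> U p y = Some x)"

definition K :: "(bool list \<Rightarrow> bool list \<Rightarrow> bool list option) \<Rightarrow> bool list \<Rightarrow> nat" where
  "K U x = Kc U x []"

definition immune_conditional ::
  "(bool list \<times> bool list) set \<Rightarrow> (bool list \<times> bool list) set \<Rightarrow> bool" where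
  "immune_conditional Y X \<longleftrightarrow>
     \<not> (\<exists>A. ce_pairs A \<and> infinite (A \<inter> X) \<and> A \<inter> X \<subseteq> Y)"

end

theory Submission
  imports Defs
begin

text \<open>
  Match strings of equal length dynamically along the enumeration of \<open>A\<close>: when \<open>(x, y)\<close> shows up and
  neither \<open>x\<close> nor \<open>y\<close> is known to be compressible or has a partner that still looks incompressible,
  they become partners; when a string is seen to be compressible it dies and its partner is free
  again. Fix \<open>q > 4 / r\<close> and write \<open>a = n div q\<close> for strings of length \<open>n\<close>.

  A partner of \<open>x\<close> is described, given \<open>x\<close>, by its index among the partners of \<open>x\<close>, which costs
  \<open>2a + O(1)\<close> bits as long as that index is below \<open>4 ^ a\<close>. A string that goes through \<open>4 ^ a\<close> partners
  has seen that many of them die while matched to it; a string dies only once, so these exhausted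
  strings are rarer than all strings by a factor of about \<open>4 ^ a\<close>. Since \<open>a\<close> can be written in unary
  with \<open>a + 1\<close> bits, listing them saves about \<open>a\<close> bits, and long exhausted strings are compressible.

  If a long pair \<open>(x, y)\<close> lies in \<open>A \<inter> R\<close>, then by maximality \<open>x\<close> or \<open>y\<close> ends up in a pair of partners
  that both survive forever. That pair is in \<open>A \<inter> R\<close>, neither component is exhausted, and hence each
  component has complexity below \<open>r n\<close> given the other.
\<close>

section \<open>Recursive functions, recursive predicates, and recursively enumerable predicates\<close>

inductive_simps eval_Zr_iff [simp]: "eval Zr xs y"
inductive_simps eval_Sc_iff: "eval Sc xs y"
inductive_simps eval_Prj_iff [simp]: "eval (Prj i) xs y"
inductive_simps eval_Cn_iff: "eval (Cn f gs) xs z"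
inductive_simps eval_Pr_0 [simp]: "eval (Pr f g) (0 # xs) y"
inductive_simps eval_Pr_Suc: "eval (Pr f g) (Suc n # xs) y"
inductive_simps eval_Pr_iff: "eval (Pr f g) xs y"
inductive_simps eval_Mn_iff: "eval (Mn f) xs n"

lemma eval_Sc_Cons [simp]: "eval Sc (x # xs) y \<longleftrightarrow> y = Suc x"
  by (auto simp: eval_Sc_iff)

lemma eval_Cn_list_all2: "eval (Cn f gs) xs z \<longleftrightarrow> (\<exists>ys. list_all2 (\<lambda>g y. eval g xs y) gs ys \<and> eval f ys z)"
  by (auto simp: eval_Cn_iff list_all2_conv_all_nth) metis

lemma eval_Cn1 [simp]: "eval (Cn f [g]) xs z \<longleftrightarrow> (\<exists>y. eval g xs y \<and> eval f [y] z)"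
  by (auto simp: eval_Cn_list_all2 list_all2_Cons1)

lemma eval_Cn2 [simp]:
  "eval (Cn f [g, h]) xs z \<longleftrightarrow> (\<exists>y y'. eval g xs y \<and> eval h xs y' \<and> eval f [y, y'] z)"
  by (auto simp: eval_Cn_list_all2 list_all2_Cons1)

lemma eval_Pr_rec_nat:
  assumes "\<And>y. eval f xs y \<longleftrightarrow> y = a" and "\<And>i v y. eval g (i # v # xs) y \<longleftrightarrow> y = h i v"
  shows "eval (Pr f g) (n # xs) y \<longleftrightarrow> y = rec_nat a h n"
  by (induction n arbitrary: y) (auto simp: assms eval_Pr_Suc)

definition rec_add :: recf where "rec_add = Pr (Prj 0) (Cn Sc [Prj 1])"
definition rec_pred :: recf where "rec_pred = Pr Zr (Prj 0)"
definition rec_diff :: recf where "rec_diff = Cn (Pr (Prj 0) (Cn rec_pred [Prj 1])) [Prj 1, Prj 0]"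
definition rec_triangle :: recf where "rec_triangle = Pr Zr (Cn Sc [Cn rec_add [Prj 0, Prj 1]])"
definition rec_pair :: recf where "rec_pair = Cn rec_add [Cn rec_triangle [rec_add], Prj 0]"
definition rec_diag :: recf where
  "rec_diag = Mn (Cn rec_diff [Cn Sc [Prj 1], Cn rec_triangle [Cn Sc [Prj 0]]])"
definition rec_fst :: recf where "rec_fst = Cn rec_diff [Prj 0, Cn rec_triangle [rec_diag]]"
definition rec_snd :: recf where "rec_snd = Cn rec_diff [rec_diag, rec_fst]"

lemma eval_rec_add [simp]: "eval rec_add [m, n] y \<longleftrightarrow> y = m + n"
proof -
  have "rec_nat n (\<lambda>_. Suc) m = m + n" by (induction m) auto
  then show ?thesis
    unfolding rec_add_def by (subst eval_Pr_rec_nat[where a = n and h = "\<lambda>_. Suc"]) auto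
qed

lemma eval_rec_pred [simp]: "eval rec_pred [n] y \<longleftrightarrow> y = n - 1"
proof -
  have "rec_nat 0 (\<lambda>i _. i) n = n - 1" by (cases n) auto
  then show ?thesis
    unfolding rec_pred_def by (subst eval_Pr_rec_nat[where a = 0 and h = "\<lambda>i _. i"]) auto
qed

lemma eval_rec_diff [simp]: "eval rec_diff [m, n] y \<longleftrightarrow> y = m - n"
proof -
  have "rec_nat m (\<lambda>_ v. v - 1) n = m - n" by (induction n) auto
  moreover have "eval (Pr (Prj 0) (Cn rec_pred [Prj 1])) [n, m] z \<longleftrightarrow> z = rec_nat m (\<lambda>_ v. v - 1) n" for z
    by (rule eval_Pr_rec_nat) auto
  ultimately show ?thesis
    unfolding rec_diff_def by auto
qed

lemma eval_rec_triangle [simp]: "eval rec_triangle [n] y \<longleftrightarrow> y = triangle n"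
proof -
  have "rec_nat 0 (\<lambda>i v. Suc (i + v)) n = triangle n" by (induction n) auto
  then show ?thesis
    unfolding rec_triangle_def
    by (subst eval_Pr_rec_nat[where a = 0 and h = "\<lambda>i v. Suc (i + v)"]) auto
qed

lemma eval_rec_pair [simp]: "eval rec_pair [m, n] y \<longleftrightarrow> y = prod_encode (m, n)"
  by (auto simp: rec_pair_def prod_encode_def)

definition pfst :: "nat \<Rightarrow> nat" where "pfst z = fst (prod_decode z)"
definition psnd :: "nat \<Rightarrow> nat" where "psnd z = snd (prod_decode z)"

lemma pfst_encode [simp]: "pfst (prod_encode (a, b)) = a"
  and psnd_encode [simp]: "psnd (prod_encode (a, b)) = b"
  and prod_encode_pfst_psnd [simp]: "prod_encode (pfst z, psnd z) = z"
  by (simp_all add: pfst_def psnd_def)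

lemma triangle_mono: "m \<le> n \<Longrightarrow> triangle m \<le> triangle n"
  by (induction rule: dec_induct) auto

lemma eval_rec_diag [simp]: "eval rec_diag [z] k \<longleftrightarrow> k = pfst z + psnd z"
proof -
  let ?s = "pfst z + psnd z"
  have z: "z = triangle ?s + pfst z"
    using prod_encode_pfst_psnd[of z] unfolding prod_encode_def by simp
  have lt: "z < triangle (Suc ?s)" by (subst z) simp
  have ge: "triangle (Suc m) \<le> z" if "m < ?s" for m
    using triangle_mono[of "Suc m" ?s] that z by linarith
  have "eval rec_diag [z] k \<longleftrightarrow>
      Suc z \<le> triangle (Suc k) \<and> (\<forall>m<k. triangle (Suc m) < Suc z)"
    by (auto simp: rec_diag_def eval_Mn_iff not_le simp del: triangle_Suc)
  also have "\<dots> \<longleftrightarrow> k = ?s"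
  proof
    assume k: "Suc z \<le> triangle (Suc k) \<and> (\<forall>m<k. triangle (Suc m) < Suc z)"
    have "\<not> k < ?s" using ge[of k] k by linarith
    moreover have "\<not> ?s < k" using lt k by (metis less_Suc_eq_le leD)
    ultimately show "k = ?s" by linarith
  qed (use lt ge in \<open>simp add: Suc_le_eq less_Suc_eq_le del: triangle_Suc\<close>)
  finally show ?thesis .
qed

lemma eval_rec_fst [simp]: "eval rec_fst [z] y \<longleftrightarrow> y = pfst z"
proof -
  have "z - triangle (pfst z + psnd z) = pfst z"
    using prod_encode_pfst_psnd[of z] unfolding prod_encode_def by simp
  then show ?thesis by (auto simp: rec_fst_def)
qed

lemma eval_rec_snd [simp]: "eval rec_snd [z] y \<longleftrightarrow> y = psnd z"
  by (auto simp: rec_snd_def)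

text \<open>Everything below is about unary functions and predicates on naturals; further variables are
  packed into the argument by the pairing function, so a bound variable \<open>i\<close> over an environment
  \<open>e\<close> appears as \<open>psnd e\<close>, and the old environment as \<open>pfst e\<close>.\<close>

definition rfun :: "(nat \<Rightarrow> nat) \<Rightarrow> bool" where
  "rfun f \<longleftrightarrow> (\<exists>r. \<forall>x y. eval r [x] y \<longleftrightarrow> y = f x)"

definition rpred :: "(nat \<Rightarrow> bool) \<Rightarrow> bool" where
  "rpred P \<longleftrightarrow> rfun (\<lambda>x. if P x then 1 else 0)"

definition repred :: "(nat \<Rightarrow> bool) \<Rightarrow> bool" where
  "repred P \<longleftrightarrow> (\<exists>T. rpred (\<lambda>e. T (pfst e) (psnd e)) \<and> (\<forall>x. P x \<longleftrightarrow> (\<exists>s. T x s)))"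

named_theorems rec_intros

lemma rfunI: "(\<And>x y. eval r [x] y \<longleftrightarrow> y = f x) \<Longrightarrow> rfun f"
  unfolding rfun_def by blast

lemma rfun_id [rec_intros]: "rfun (\<lambda>e. e)"
  by (rule rfunI[of "Prj 0"]) auto

lemma rfun_comp: "rfun f \<Longrightarrow> rfun g \<Longrightarrow> rfun (\<lambda>e. f (g e))"
  unfolding rfun_def
proof (elim exE)
  fix r s assume "\<forall>x y. eval r [x] y \<longleftrightarrow> y = f x" "\<forall>x y. eval s [x] y \<longleftrightarrow> y = g x"
  then show "\<exists>t. \<forall>x y. eval t [x] y \<longleftrightarrow> y = f (g x)" by (intro exI[of _ "Cn r [s]"]) simp
qed

lemma rfun_binary:
  assumes "\<And>m n y. eval r [m, n] y \<longleftrightarrow> y = h m n" and "rfun f" and "rfun g"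
  shows "rfun (\<lambda>e. h (f e) (g e))"
  using assms(2,3) unfolding rfun_def
proof (elim exE)
  fix s t assume "\<forall>x y. eval s [x] y \<longleftrightarrow> y = f x" "\<forall>x y. eval t [x] y \<longleftrightarrow> y = g x"
  then show "\<exists>r. \<forall>x y. eval r [x] y \<longleftrightarrow> y = h (f x) (g x)"
    by (intro exI[of _ "Cn r [s, t]"]) (simp add: assms(1))
qed

lemmas rfun_add [rec_intros] = rfun_binary[OF eval_rec_add]
  and rfun_diff [rec_intros] = rfun_binary[OF eval_rec_diff]
  and rfun_pair [rec_intros] = rfun_binary[OF eval_rec_pair]

lemma rfun_Suc [rec_intros]: "rfun f \<Longrightarrow> rfun (\<lambda>e. Suc (f e))"
  by (rule rfun_comp[OF rfunI[of Sc]]) simp_all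

lemma rfun_pfst [rec_intros]: "rfun f \<Longrightarrow> rfun (\<lambda>e. pfst (f e))"
  by (rule rfun_comp[OF rfunI[of rec_fst]]) simp_all

lemma rfun_psnd [rec_intros]: "rfun f \<Longrightarrow> rfun (\<lambda>e. psnd (f e))"
  by (rule rfun_comp[OF rfunI[of rec_snd]]) simp_all

lemma rfun_const [rec_intros]: "rfun (\<lambda>e. c)"
proof (induction c)
  case 0 show ?case by (rule rfunI[of Zr]) simp
qed (rule rfun_Suc)

lemma rfun_rec_nat [rec_intros]:
  assumes "rfun a" and "rfun (\<lambda>e. h (pfst e) (pfst (psnd e)) (psnd (psnd e)))" and "rfun n"
  shows "rfun (\<lambda>e. rec_nat (a e) (h e) (n e))"
proof -
  from assms obtain ra rh rn where r: "\<And>x y. eval ra [x] y \<longleftrightarrow> y = a x"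
    "\<And>x y. eval rh [x] y \<longleftrightarrow> y = h (pfst x) (pfst (psnd x)) (psnd (psnd x))"
    "\<And>x y. eval rn [x] y \<longleftrightarrow> y = n x"
    unfolding rfun_def by metis
  let ?g = "Cn rh [Cn rec_pair [Prj 2, Cn rec_pair [Prj 0, Prj 1]]]"
  have "eval (Pr ra ?g) [k, x] y \<longleftrightarrow> y = rec_nat (a x) (h x) k" for k x y
    by (rule eval_Pr_rec_nat) (auto simp: r)
  then show ?thesis
    unfolding rfun_def by (intro exI[of _ "Cn (Pr ra ?g) [rn, Prj 0]"]) (simp add: r)
qed

lemma rfun_mult [rec_intros]: "rfun f \<Longrightarrow> rfun g \<Longrightarrow> rfun (\<lambda>e. f e * g e)"
proof -
  have eq: "m * n = rec_nat 0 (\<lambda>i v. v + n) m" for m n :: nat by (induction m) auto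
  assume "rfun f" and g: "rfun g"
  then show ?thesis unfolding eq by (intro rec_intros rfun_comp[OF g])
qed

lemma rfun_power [rec_intros]: "rfun f \<Longrightarrow> rfun g \<Longrightarrow> rfun (\<lambda>e. f e ^ g e)"
proof -
  have eq: "m ^ n = rec_nat 1 (\<lambda>i v. m * v) n" for m n :: nat by (induction n) auto
  assume f: "rfun f" and "rfun g"
  then show ?thesis unfolding eq by (intro rec_intros rfun_comp[OF f])
qed

lemma rpred_comp: "rpred P \<Longrightarrow> rfun f \<Longrightarrow> rpred (\<lambda>e. P (f e))"
  unfolding rpred_def by (rule rfun_comp[where f = "\<lambda>x. if P x then 1 else 0"])

lemma rfun_if [rec_intros]:
  assumes "rpred P" "rfun f" "rfun g"
  shows "rfun (\<lambda>e. if P e then f e else g e)"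
proof -
  have eq: "(if P e then f e else g e) =
      (if P e then 1 else 0) * f e + (1 - (if P e then 1 else 0)) * g e" for e by simp
  show ?thesis
    unfolding eq by (intro rec_intros assms(2,3) assms(1)[unfolded rpred_def])
qed

lemma rpred_le [rec_intros]: "rfun f \<Longrightarrow> rfun g \<Longrightarrow> rpred (\<lambda>e. f e \<le> g e)"
proof -
  have eq: "(if f e \<le> g e then 1 else 0) = 1 - (f e - g e)" for e by simp
  assume "rfun f" "rfun g"
  then show ?thesis by (subst rpred_def, unfold eq) (intro rec_intros)
qed

lemma rpred_not [rec_intros]: "rpred P \<Longrightarrow> rpred (\<lambda>e. \<not> P e)"
proof -
  have eq: "(if \<not> P e then 1 else 0) = 1 - (if P e then 1 else (0::nat))" for e by simp
  assume "rpred P"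
  then show ?thesis by (subst rpred_def, unfold eq) (intro rec_intros)
qed

lemma rpred_conj [rec_intros]: "rpred P \<Longrightarrow> rpred Q \<Longrightarrow> rpred (\<lambda>e. P e \<and> Q e)"
proof -
  have eq: "(if P e \<and> Q e then 1 else 0) = (if P e then 1 else 0) * (if Q e then 1 else (0::nat))" for e
    by simp
  assume "rpred P" "rpred Q"
  then show ?thesis by (subst rpred_def, unfold eq) (intro rec_intros)
qed

lemma rpred_imp [rec_intros]: "rpred P \<Longrightarrow> rpred Q \<Longrightarrow> rpred (\<lambda>e. P e \<longrightarrow> Q e)"
  using rpred_not[OF rpred_conj[OF _ rpred_not], of P Q] by simp

lemma rpred_less [rec_intros]: "rfun f \<Longrightarrow> rfun g \<Longrightarrow> rpred (\<lambda>e. f e < g e)"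
  using rpred_le[OF rfun_Suc, of f g] by (simp add: Suc_le_eq)

lemma rpred_eq [rec_intros]: "rfun f \<Longrightarrow> rfun g \<Longrightarrow> rpred (\<lambda>e. f e = g e)"
  unfolding eq_iff by (intro rec_intros)

lemma rfun_card [rec_intros]:
  assumes "rfun n" and "rpred (\<lambda>e. P (pfst e) (psnd e))"
  shows "rfun (\<lambda>e. card {i. i < n e \<and> P e i})"
proof -
  have "{i. i < Suc k \<and> P e i} =
      (if P e k then insert k {i. i < k \<and> P e i} else {i. i < k \<and> P e i})" for e k
    by (auto simp: less_Suc_eq)
  then have eq: "card {i. i < k \<and> P e i} = rec_nat 0 (\<lambda>i v. if P e i then Suc v else v) k" for e k
    by (induction k) auto
  have "rpred (\<lambda>e. P (pfst e) (pfst (psnd e)))"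
    using rpred_comp[OF assms(2), of "\<lambda>e. prod_encode (pfst e, pfst (psnd e))"]
    by (simp add: rfun_pair rfun_pfst rfun_psnd rfun_id)
  then show ?thesis unfolding eq by (intro rec_intros assms)
qed

lemma rpred_bex [rec_intros]:
  assumes "rfun n" and "rpred (\<lambda>e. P (pfst e) (psnd e))"
  shows "rpred (\<lambda>e. \<exists>i<n e. P e i)"
proof -
  have eq: "(\<exists>i<n e. P e i) \<longleftrightarrow> 0 < card {i. i < n e \<and> P e i}" for e
    by (auto simp: card_gt_0_iff)
  show ?thesis unfolding eq by (intro rec_intros assms)
qed

lemma rpred_ball [rec_intros]:
  assumes "rfun n" and "rpred (\<lambda>e. P (pfst e) (psnd e))"
  shows "rpred (\<lambda>e. \<forall>i<n e. P e i)"
  using rpred_not[OF rpred_bex[OF assms(1) rpred_not[OF assms(2)]]] by simp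

lemma rfun_div [rec_intros]: "rfun f \<Longrightarrow> rfun g \<Longrightarrow> rfun (\<lambda>e. f e div g e)"
proof -
  have eq: "m div n = card {i. i < m \<and> 0 < n \<and> Suc i * n \<le> m}" for m n :: nat
  proof (cases "n = 0")
    case False
    have "Suc i * n \<le> m \<longleftrightarrow> i < m div n" for i
      using False less_eq_div_iff_mult_less_eq[of n "Suc i" m] by (simp only: Suc_le_eq neq0_conv)
    moreover have "i < m" if "i < m div n" for i
      using that div_le_dividend[of m n] by linarith
    ultimately have "{i. i < m \<and> 0 < n \<and> Suc i * n \<le> m} = {..<m div n}"
      using False by auto
    then show ?thesis by simp
  qed simp
  assume f: "rfun f" and g: "rfun g"
  then show ?thesis unfolding eq by (intro rec_intros rfun_comp[OF f] rfun_comp[OF g])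
qed

lemma rpred_odd [rec_intros]: "rfun f \<Longrightarrow> rpred (\<lambda>e. odd (f e))"
proof -
  have eq: "odd n \<longleftrightarrow> n - 2 * (n div 2) = 1" for n :: nat by presburger
  assume "rfun f"
  then show ?thesis unfolding eq by (intro rec_intros)
qed

text \<open>Course-of-values recursion: the history of a predicate is kept as a bit set.\<close>

lemma rpred_history:
  assumes C: "rpred (\<lambda>e. C (pfst e) (psnd e))"
    and P: "\<And>s. P s \<longleftrightarrow> C s (set_encode {t. t < s \<and> P t})"
  shows "rpred P"
proof -
  let ?h = "\<lambda>s. set_encode {t. t < s \<and> P t}"
  have "{t. t < Suc s \<and> P t} = (if P s then insert s {t. t < s \<and> P t} else {t. t < s \<and> P t})" for s
    by (auto simp: less_Suc_eq)
  then have "?h (Suc s) = (if C s (?h s) then 2 ^ s + ?h s else ?h s)" for s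
    using P[of s] by simp
  then have h: "?h s = rec_nat 0 (\<lambda>i v. if C i v then 2 ^ i + v else v) s" for s
    by (induction s) simp_all
  have 1: "rpred (\<lambda>e. C (pfst (psnd e)) (psnd (psnd e)))"
    by (rule rpred_comp[OF C]) (intro rec_intros)
  have "rfun ?h" unfolding h by (intro rec_intros 1)
  then have "rpred (\<lambda>s. C (pfst (prod_encode (s, ?h s))) (psnd (prod_encode (s, ?h s))))"
    by (intro rpred_comp[OF C] rec_intros)
  then show ?thesis by (simp only: pfst_encode psnd_encode P[symmetric])
qed

lemma repredI: "rpred (\<lambda>e. T (pfst e) (psnd e)) \<Longrightarrow> (\<And>x. P x \<longleftrightarrow> (\<exists>s. T x s)) \<Longrightarrow> repred P"
  unfolding repred_def by blast

lemma repred_rpred: "rpred P \<Longrightarrow> repred P"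
  by (rule repredI[of "\<lambda>x s. P x"]) (simp_all add: rpred_comp[of P] rfun_pfst rfun_id)

lemma repred_comp: "repred P \<Longrightarrow> rfun f \<Longrightarrow> repred (\<lambda>e. P (f e))"
  unfolding repred_def
proof (elim exE conjE)
  fix T assume T: "rpred (\<lambda>e. T (pfst e) (psnd e))" "\<forall>x. P x \<longleftrightarrow> (\<exists>s. T x s)" and f: "rfun f"
  have "rpred (\<lambda>e. T (f (pfst e)) (psnd e))"
    using rpred_comp[OF T(1), of "\<lambda>e. prod_encode (f (pfst e), psnd e)"]
    by (simp add: f rfun_comp[of f] rfun_pair rfun_pfst rfun_psnd rfun_id)
  then show "\<exists>T. rpred (\<lambda>e. T (pfst e) (psnd e)) \<and> (\<forall>x. P (f x) \<longleftrightarrow> (\<exists>s. T x s))"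
    using T(2) by (intro exI[of _ "\<lambda>x s. T (f x) s"]) simp
qed

lemma repred_ex:
  assumes "repred (\<lambda>e. P (pfst e) (psnd e))"
  shows "repred (\<lambda>e. \<exists>i. P e i)"
proof -
  obtain T where T: "rpred (\<lambda>e. T (pfst e) (psnd e))" "\<And>x. P (pfst x) (psnd x) \<longleftrightarrow> (\<exists>s. T x s)"
    using assms unfolding repred_def by blast
  show ?thesis
  proof (rule repredI)
    show "rpred (\<lambda>e. T (prod_encode (pfst e, pfst (psnd e))) (psnd (psnd e)))"
      using rpred_comp[OF T(1), of "\<lambda>e. prod_encode (prod_encode (pfst e, pfst (psnd e)), psnd (psnd e))"]
      by (simp add: rfun_pair rfun_pfst rfun_psnd rfun_id)
    show "(\<exists>i. P e i) \<longleftrightarrow> (\<exists>s. T (prod_encode (e, pfst s)) (psnd s))" for e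
      using T(2)[of "prod_encode (e, _)"] by (metis pfst_encode psnd_encode)
  qed
qed

lemma repred_conj:
  assumes "repred P" "repred Q"
  shows "repred (\<lambda>e. P e \<and> Q e)"
proof -
  obtain S T where ST: "rpred (\<lambda>e. S (pfst e) (psnd e))" "\<And>x. P x \<longleftrightarrow> (\<exists>s. S x s)"
    "rpred (\<lambda>e. T (pfst e) (psnd e))" "\<And>x. Q x \<longleftrightarrow> (\<exists>s. T x s)"
    using assms unfolding repred_def by blast
  show ?thesis
  proof (rule repredI)
    show "rpred (\<lambda>e. S (pfst e) (pfst (psnd e)) \<and> T (pfst e) (psnd (psnd e)))"
      using rpred_comp[OF ST(1), of "\<lambda>e. prod_encode (pfst e, pfst (psnd e))"]
        rpred_comp[OF ST(3), of "\<lambda>e. prod_encode (pfst e, psnd (psnd e))"]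
      by (intro rec_intros) (simp_all add: rfun_pair rfun_pfst rfun_psnd rfun_id)
    show "P e \<and> Q e \<longleftrightarrow> (\<exists>s. S e (pfst s) \<and> T e (psnd s))" for e
      using ST by (metis pfst_encode psnd_encode)
  qed
qed

lemma repred_ball:
  assumes "rfun n" and "repred (\<lambda>e. P (pfst e) (psnd e))"
  shows "repred (\<lambda>e. \<forall>i<n e. P e i)"
proof -
  obtain T where T: "rpred (\<lambda>e. T (pfst e) (psnd e))" "\<And>x. P (pfst x) (psnd x) \<longleftrightarrow> (\<exists>s. T x s)"
    using assms(2) unfolding repred_def by blast
  show ?thesis
  proof (rule repredI)
    have "rpred (\<lambda>e. T (prod_encode (pfst (pfst (pfst e)), psnd (pfst e))) (psnd e))"
      using rpred_comp[OF T(1), of "\<lambda>e. prod_encode (prod_encode (pfst (pfst (pfst e)), psnd (pfst e)), psnd e)"]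
      by (simp add: rfun_pair rfun_pfst rfun_psnd rfun_id)
    then show "rpred (\<lambda>e. \<forall>i<n (pfst e). \<exists>t<psnd e. T (prod_encode (pfst e, i)) t)"
      by (intro rec_intros rfun_comp[OF assms(1)])
    show "(\<forall>i<n e. P e i) \<longleftrightarrow> (\<exists>s. \<forall>i<n e. \<exists>t<s. T (prod_encode (e, i)) t)" for e
    proof
      assume "\<forall>i<n e. P e i"
      then have "\<forall>i<n e. \<exists>t. T (prod_encode (e, i)) t"
        using T(2)[of "prod_encode (e, _)"] by simp
      then obtain w where w: "\<And>i. i < n e \<Longrightarrow> T (prod_encode (e, i)) (w i)" by metis
      have "w i < Suc (Max (w ` {..<n e}))" if "i < n e" for i
        using that by (simp add: less_Suc_eq_le)
      then show "\<exists>s. \<forall>i<n e. \<exists>t<s. T (prod_encode (e, i)) t" using w by blast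
    qed (use T(2)[of "prod_encode (e, _)"] in auto)
  qed
qed


lemma list_decode_0_iff [simp]: "list_decode c = [] \<longleftrightarrow> c = 0"
  by (metis list_decode.simps(1) list_decode_inverse list_encode.simps(1))

lemma list_decode_Suc_prod_encode [simp]:
  "list_decode (Suc (prod_encode (x, c))) = x # list_decode c"
  by simp

lemma list_decode_pos: "c \<noteq> 0 \<Longrightarrow> list_decode c = pfst (c - 1) # list_decode (psnd (c - 1))"
  by (cases c) (simp_all add: pfst_def psnd_def split: prod.splits)

definition cdrop :: "nat \<Rightarrow> nat \<Rightarrow> nat" where
  "cdrop c i = rec_nat c (\<lambda>_ v. psnd (v - 1)) i"

definition cnth :: "nat \<Rightarrow> nat \<Rightarrow> nat" where
  "cnth c i = pfst (cdrop c i - 1)"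

lemma rfun_cdrop [rec_intros]: "rfun f \<Longrightarrow> rfun g \<Longrightarrow> rfun (\<lambda>e. cdrop (f e) (g e))"
  unfolding cdrop_def by (intro rec_intros)

lemma rfun_cnth [rec_intros]: "rfun f \<Longrightarrow> rfun g \<Longrightarrow> rfun (\<lambda>e. cnth (f e) (g e))"
  unfolding cnth_def by (intro rec_intros)

lemma cdrop_list_encode: "i \<le> length xs \<Longrightarrow> cdrop (list_encode xs) i = list_encode (drop i xs)"
proof (induction i)
  case (Suc i)
  then have "drop i xs = xs ! i # drop (Suc i) xs" by (simp add: Cons_nth_drop_Suc)
  with Suc show ?case by (simp add: cdrop_def)
qed (simp add: cdrop_def)

lemma cnth_list_encode: "i < length xs \<Longrightarrow> cnth (list_encode xs) i = xs ! i"
  by (simp add: cnth_def cdrop_list_encode Cons_nth_drop_Suc[symmetric] del: Cons_nth_drop_Suc)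

lemma eval_Pr_sequence:
  "eval (Pr f g) (n # xs) y \<longleftrightarrow>
    (\<exists>v. eval f xs (v 0) \<and> (\<forall>i<n. eval g (i # v i # xs) (v (Suc i))) \<and> y = v n)"
proof (induction n arbitrary: y)
  case 0
  show ?case by (auto intro: exI[of _ "\<lambda>_. y"])
next
  case (Suc n)
  show ?case
  proof
    assume "eval (Pr f g) (Suc n # xs) y"
    then obtain v where v: "eval f xs (v 0)" "\<forall>i<n. eval g (i # v i # xs) (v (Suc i))"
      "eval g (n # v n # xs) y"
      by (auto simp: eval_Pr_Suc Suc)
    then show "\<exists>v. eval f xs (v 0) \<and> (\<forall>i<Suc n. eval g (i # v i # xs) (v (Suc i))) \<and> y = v (Suc n)"
      by (intro exI[of _ "v(Suc n := y)"]) (auto simp: less_Suc_eq)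
  next
    assume "\<exists>v. eval f xs (v 0) \<and> (\<forall>i<Suc n. eval g (i # v i # xs) (v (Suc i))) \<and> y = v (Suc n)"
    then obtain v where v: "eval f xs (v 0)" "\<forall>i<Suc n. eval g (i # v i # xs) (v (Suc i))" "y = v (Suc n)"
      by blast
    then have "eval (Pr f g) (n # xs) (v n)" unfolding Suc by (intro exI[of _ v]) simp
    with v show "eval (Pr f g) (Suc n # xs) y" unfolding eval_Pr_Suc by blast
  qed
qed

lemma eval_Pr_code:
  "eval (Pr f g) (n # xs) y \<longleftrightarrow>
    (\<exists>c. eval f xs (cnth c 0) \<and> (\<forall>i<n. eval g (i # cnth c i # xs) (cnth c (Suc i))) \<and> y = cnth c n)"
proof
  assume "eval (Pr f g) (n # xs) y"
  then obtain v where v: "eval f xs (v 0)" "\<forall>i<n. eval g (i # v i # xs) (v (Suc i))" "y = v n"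
    by (auto simp: eval_Pr_sequence)
  define c where "c = list_encode (map v [0..<Suc n])"
  have "cnth c i = v i" if "i \<le> n" for i
    using that by (simp add: c_def cnth_list_encode del: upt_Suc)
  then show "\<exists>c. eval f xs (cnth c 0) \<and> (\<forall>i<n. eval g (i # cnth c i # xs) (cnth c (Suc i))) \<and> y = cnth c n"
    using v by (intro exI[of _ c]) auto
qed (auto simp: eval_Pr_sequence)

lemma repred_eval_comp:
  assumes "repred (\<lambda>e. eval f (list_decode (pfst e)) (psnd e))" and "rfun a" and "rfun b"
  shows "repred (\<lambda>e. eval f (list_decode (a e)) (b e))"
  using repred_comp[OF assms(1) rfun_pair[OF assms(2,3)]] by simp

lemma repred_list_all2_eval:
  assumes "\<And>g. g \<in> set gs \<Longrightarrow> repred (\<lambda>e. eval g (list_decode (pfst e)) (psnd e))"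
  shows "repred (\<lambda>e. list_all2 (\<lambda>g y. eval g (list_decode (pfst e)) y) gs (list_decode (psnd e)))"
  using assms
proof (induction gs)
  case Nil
  have "repred (\<lambda>e. psnd e = 0)" by (intro repred_rpred rec_intros)
  then show ?case by simp
next
  case (Cons g gs)
  let ?P = "\<lambda>gs a c. list_all2 (\<lambda>g y. eval g (list_decode a) y) gs (list_decode c)"
  have eq: "?P (g # gs) a c \<longleftrightarrow>
      c \<noteq> 0 \<and> eval g (list_decode a) (pfst (c - 1)) \<and> ?P gs a (psnd (c - 1))" for a c
    by (cases "c = 0") (simp_all add: list_decode_pos)
  have "repred (\<lambda>e. ?P gs (pfst e) (psnd e))"
    using Cons by simp
  from repred_comp[OF this, of "\<lambda>e. prod_encode (pfst e, psnd (psnd e - 1))"]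
  have 1: "repred (\<lambda>e. ?P gs (pfst e) (psnd (psnd e - 1)))"
    by (simp add: rfun_pair rfun_pfst rfun_psnd rfun_id rfun_diff rfun_const)
  have 2: "repred (\<lambda>e. eval g (list_decode (pfst e)) (pfst (psnd e - 1)))"
    by (rule repred_eval_comp[OF Cons.prems]) (simp, (intro rec_intros)+)
  have 3: "repred (\<lambda>e. psnd e \<noteq> 0)" by (intro repred_rpred rec_intros)
  show ?case unfolding eq by (intro repred_conj 1 2 3)
qed

lemma repred_eval: "repred (\<lambda>e. eval f (list_decode (pfst e)) (psnd e))"
proof (induction f)
  case Zr
  have "repred (\<lambda>e. psnd e = 0)" by (intro repred_rpred rec_intros)
  then show ?case by simp
next
  case Sc
  have eq: "eval Sc (list_decode c) y \<longleftrightarrow> c \<noteq> 0 \<and> y = Suc (pfst (c - 1))" for c y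
    by (cases "c = 0") (simp_all add: list_decode_pos eval_Sc_iff)
  show ?case unfolding eq by (intro repred_rpred rec_intros)
next
  case (Prj i)
  show ?case
  proof (induction i)
    case 0
    have eq: "eval (Prj 0) (list_decode c) y \<longleftrightarrow> c \<noteq> 0 \<and> y = pfst (c - 1)" for c y
      by (cases "c = 0") (simp_all add: list_decode_pos)
    show ?case unfolding eq by (intro repred_rpred rec_intros)
  next
    case (Suc i)
    have eq: "eval (Prj (Suc i)) (list_decode c) y \<longleftrightarrow>
        c \<noteq> 0 \<and> eval (Prj i) (list_decode (psnd (c - 1))) y" for c y
      by (cases "c = 0") (simp_all add: list_decode_pos)
    have 1: "repred (\<lambda>e. pfst e \<noteq> 0)" by (intro repred_rpred rec_intros)
    have 2: "repred (\<lambda>e. eval (Prj i) (list_decode (psnd (pfst e - 1))) (psnd e))"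
      by (rule repred_eval_comp[OF Suc]) (intro rec_intros)+
    show ?case unfolding eq by (intro repred_conj 1 2)
  qed
next
  case (Cn f gs)
  have eq: "eval (Cn f gs) xs z \<longleftrightarrow>
      (\<exists>c. list_all2 (\<lambda>g y. eval g xs y) gs (list_decode c) \<and> eval f (list_decode c) z)" for xs z
    unfolding eval_Cn_list_all2 by (metis list_encode_inverse)
  from repred_comp[OF repred_list_all2_eval[OF Cn.IH(2)], of gs "\<lambda>e. prod_encode (pfst (pfst e), psnd e)"]
  have 1: "repred (\<lambda>e. list_all2 (\<lambda>g y. eval g (list_decode (pfst (pfst e))) y) gs (list_decode (psnd e)))"
    by (simp add: rfun_pair rfun_pfst rfun_psnd rfun_id)
  show ?case unfolding eq
    by (intro repred_ex repred_conj 1 repred_eval_comp[OF Cn.IH(1)] rec_intros)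
next
  case (Pr f g)
  have eq: "eval (Pr f g) (list_decode a) y \<longleftrightarrow> a \<noteq> 0 \<and>
      (\<exists>c. eval f (list_decode (psnd (a - 1))) (cnth c 0) \<and>
        (\<forall>i<pfst (a - 1).
           eval g (list_decode (Suc (prod_encode (i, Suc (prod_encode (cnth c i, psnd (a - 1)))))))
             (cnth c (Suc i))) \<and>
        y = cnth c (pfst (a - 1)))" for a y
    by (cases "a = 0")
       (simp_all add: list_decode_pos eval_Pr_code eval_Pr_iff[of _ _ "[]"] del: list_decode.simps(2))
  show ?case unfolding eq
    by (intro repred_ex repred_conj repred_ball repred_eval_comp[OF Pr.IH(1)] repred_eval_comp[OF Pr.IH(2)]
          rec_intros)
       (intro repred_rpred rec_intros)+
next
  case (Mn f)
  have eq: "eval (Mn f) (list_decode a) n \<longleftrightarrow> eval f (list_decode (Suc (prod_encode (n, a)))) 0 \<and>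
      (\<forall>m<n. \<exists>y. eval f (list_decode (Suc (prod_encode (m, a)))) y \<and> y \<noteq> 0)" for a n
    by (simp add: eval_Mn_iff del: list_decode.simps(2))
  show ?case unfolding eq
    by (intro repred_ex repred_conj repred_ball repred_eval_comp[OF Mn.IH] rec_intros)
       (intro repred_rpred rec_intros)+
qed

lemma recf_of_repred:
  assumes "repred (\<lambda>e. Q (pfst (pfst e)) (psnd (pfst e)) (psnd e))"
    and unique: "\<And>p y z z'. Q p y z \<Longrightarrow> Q p y z' \<Longrightarrow> z = z'"
  shows "\<exists>f. \<forall>p y z. eval f [p, y] z \<longleftrightarrow> Q p y z"
proof -
  obtain T where T: "rpred (\<lambda>e. T (pfst e) (psnd e))"
    "\<And>x. Q (pfst (pfst x)) (psnd (pfst x)) (psnd x) \<longleftrightarrow> (\<exists>s. T x s)"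
    using assms(1) unfolding repred_def by blast
  let ?G = "\<lambda>p y w. T (prod_encode (prod_encode (p, y), pfst w)) (psnd w)"
  have Q: "Q p y z \<longleftrightarrow> (\<exists>w. ?G p y w \<and> z = pfst w)" for p y z
    using T(2)[of "prod_encode (prod_encode (p, y), z)"] by (metis pfst_encode psnd_encode)
  have "rpred (\<lambda>e. ?G (pfst (psnd e)) (psnd (psnd e)) (pfst e))"
    using rpred_comp[OF T(1), of "\<lambda>e. prod_encode (prod_encode (psnd e, pfst (pfst e)), psnd (pfst e))"]
    by (simp add: rfun_pair rfun_pfst rfun_psnd rfun_id)
  then have "rfun (\<lambda>e. if ?G (pfst (psnd e)) (psnd (psnd e)) (pfst e) then 0 else 1)"
    by (intro rec_intros)
  then obtain g where g: "\<And>e v. eval g [e] v \<longleftrightarrow>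
      v = (if ?G (pfst (psnd e)) (psnd (psnd e)) (pfst e) then 0 else 1)"
    unfolding rfun_def by blast
  let ?m = "Mn (Cn g [Cn rec_pair [Prj 0, Cn rec_pair [Prj 1, Prj 2]]])"
  have m: "eval ?m [p, y] w \<longleftrightarrow> ?G p y w \<and> (\<forall>v<w. \<not> ?G p y v)" for p y w
    by (auto simp: eval_Mn_iff g)
  have "eval (Cn rec_fst [?m]) [p, y] z \<longleftrightarrow> Q p y z" for p y z
  proof
    assume "eval (Cn rec_fst [?m]) [p, y] z"
    then obtain w where "eval ?m [p, y] w" "z = pfst w" unfolding eval_Cn1 eval_rec_fst by blast
    then show "Q p y z" unfolding m Q by blast
  next
    assume z: "Q p y z"
    then have "\<exists>w. ?G p y w" unfolding Q by blast
    then obtain w where "?G p y w" "\<forall>v<w. \<not> ?G p y v"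
      unfolding exists_least_iff[of "?G p y"] by blast
    moreover from this have "z = pfst w" using unique[OF z] Q by blast
    ultimately have "eval ?m [p, y] w \<and> z = pfst w" unfolding m by blast
    then show "eval (Cn rec_fst [?m]) [p, y] z" unfolding eval_Cn1 eval_rec_fst by blast
  qed
  then show ?thesis by blast
qed

section \<open>Machines given by enumerable relations on string codes\<close>

lemma inj_str_code: "inj str_code"
proof (rule injI)
  fix x y show "str_code x = str_code y \<Longrightarrow> x = y"
  proof (induction x arbitrary: y)
    case Nil then show ?case by (cases y) (auto split: if_splits)
  next
    case (Cons b x)
    then obtain b' y' where y: "y = b' # y'" by (cases y) (auto split: if_splits)
    have "b = b' \<and> str_code x = str_code y'"
      using Cons.prems by (cases b; cases b'; simp add: y; presburger)
    with Cons.IH y show ?case by simp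
  qed
qed

lemma str_code_eq_iff [simp]: "str_code x = str_code y \<longleftrightarrow> x = y"
  using inj_str_code by (auto dest: injD)

lemma surj_str_code: "\<exists>x. str_code x = c"
proof (induction c rule: less_induct)
  case (less c)
  show ?case
  proof (cases "c = 0")
    case True then show ?thesis by (intro exI[of _ "[]"]) simp
  next
    case False
    then obtain x where "str_code x = (c - 1) div 2"
      using less[of "(c - 1) div 2"] by (metis bot_nat_0.not_eq_extremum diff_less div_le_dividend le_less_trans zero_less_one)
    then have "str_code (even c # x) = c" using False by (simp, presburger)
    then show ?thesis ..
  qed
qed

definition clen :: "nat \<Rightarrow> nat" where
  "clen c = card {i. i < c \<and> 2 ^ Suc i \<le> Suc c}"

lemma rfun_clen [rec_intros]:
  assumes "rfun f"
  shows "rfun (\<lambda>e. clen (f e))"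
  unfolding clen_def by (intro rec_intros assms rfun_comp[OF assms])

lemma str_code_bounds: "2 ^ length x \<le> Suc (str_code x) \<and> Suc (str_code x) < 2 ^ Suc (length x)"
  by (induction x) auto

lemma clen_str_code [simp]: "clen (str_code x) = length x"
proof -
  let ?c = "str_code x"
  have "i < ?c \<and> 2 ^ Suc i \<le> Suc ?c \<longleftrightarrow> i < length x" for i
  proof
    assume "i < ?c \<and> 2 ^ Suc i \<le> Suc ?c"
    then have "(2::nat) ^ Suc i < 2 ^ Suc (length x)" using str_code_bounds[of x] by linarith
    then show "i < length x" by simp
  next
    assume "i < length x"
    then have "(2::nat) ^ Suc i \<le> 2 ^ length x" by (intro power_increasing) auto
    then have le: "2 ^ Suc i \<le> Suc ?c" using str_code_bounds[of x] by linarith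
    moreover have "Suc i < 2 ^ Suc i" by (rule less_exp)
    ultimately show "i < ?c \<and> 2 ^ Suc i \<le> Suc ?c" by linarith
  qed
  then have "{i. i < ?c \<and> 2 ^ Suc i \<le> Suc ?c} = {..<length x}" by auto
  then show ?thesis by (simp add: clen_def)
qed

lemma clen_bounds: "2 ^ clen c \<le> Suc c \<and> Suc c < 2 ^ Suc (clen c)"
  by (metis clen_str_code str_code_bounds surj_str_code)

lemma finite_clen_le: "finite {c. clen c \<le> n}"
proof (rule finite_subset)
  show "{c. clen c \<le> n} \<subseteq> {..2 ^ Suc n}"
  proof (clarsimp)
    fix c assume "clen c \<le> n"
    then have "(2::nat) ^ Suc (clen c) \<le> 2 ^ Suc n" by (intro power_increasing) auto
    then show "c \<le> 2 * 2 ^ n" using clen_bounds[of c] unfolding power_Suc by linarith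
  qed
qed simp

text \<open>The \<open>i\<close>-th string of length \<open>n\<close> has code \<open>2 ^ n - 1 + i\<close>.\<close>

lemma obtain_string_index:
  assumes "i < 2 ^ n"
  obtains w where "length w = n" "Suc (str_code w) = 2 ^ n + i"
proof -
  obtain w where "str_code w = 2 ^ n + i - 1" using surj_str_code by blast
  then have w: "Suc (str_code w) = 2 ^ n + i" by simp
  have "(2::nat) ^ length w < 2 ^ Suc n" "(2::nat) ^ n < 2 ^ Suc (length w)"
    using str_code_bounds[of w] w assms by auto
  then have "length w = n" by (simp only: power_strict_increasing_iff one_less_numeral_iff semiring_norm less_Suc_eq_le le_antisym)
  with w that show thesis by blast
qed

lemma machine_of_repred:
  assumes "repred (\<lambda>e. Q (pfst (pfst e)) (psnd (pfst e)) (psnd e))"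
    and unique: "\<And>p y z z'. Q p y z \<Longrightarrow> Q p y z' \<Longrightarrow> z = z'"
  obtains M where "partial_computable2 M"
    and "\<And>p y w. M p y = Some w \<longleftrightarrow> Q (str_code p) (str_code y) (str_code w)"
proof -
  define M where "M p y = (if \<exists>w. Q (str_code p) (str_code y) (str_code w)
    then Some (SOME w. Q (str_code p) (str_code y) (str_code w)) else None)" for p y
  have M: "M p y = Some w \<longleftrightarrow> Q (str_code p) (str_code y) (str_code w)" for p y w
    unfolding M_def using unique by (auto intro: someI) (metis someI str_code_eq_iff)+
  obtain f where f: "\<And>p y z. eval f [p, y] z \<longleftrightarrow> Q p y z"
    using recf_of_repred[of Q, OF assms(1)] unique by blast
  have "partial_computable2 M"
    unfolding partial_computable2_def
  proof (intro exI[of _ f] allI)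
    fix p y z
    obtain w where "str_code w = z" using surj_str_code by blast
    then show "eval f [str_code p, str_code y] z \<longleftrightarrow> (\<exists>w. M p y = Some w \<and> z = str_code w)"
      by (auto simp: f M)
  qed
  with M that show thesis by blast
qed

lemma universal_pf_simulates:
  assumes "universal_pf U" and "partial_computable2 M"
    and "\<And>y. prefix_free {p. M p y \<noteq> None}"
  shows "\<exists>c. \<forall>p y w. M p y = Some w \<longrightarrow> Kc U w y \<le> length p + c"
proof -
  obtain \<rho> where \<rho>: "\<And>p y. U (\<rho> @ p) y = M p y"
    using assms unfolding universal_pf_def pf_machine_def by blast
  have "Kc U w y \<le> length p + length \<rho>" if "M p y = Some w" for p y w
    unfolding Kc_def using that by (intro Least_le exI[of _ "\<rho> @ p"]) (simp add: \<rho>)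
  then show ?thesis by blast
qed

lemma universal_pf_surj:
  assumes "universal_pf U"
  shows "\<exists>p. U p y = Some x"
proof -
  let ?Q = "\<lambda>p y z. p = 0 \<and> z = str_code x"
  have Q: "repred (\<lambda>e. ?Q (pfst (pfst e)) (psnd (pfst e)) (psnd e))"
    by (intro repred_rpred rec_intros)
  obtain M where M: "partial_computable2 M"
    "\<And>p y w. M p y = Some w \<longleftrightarrow> ?Q (str_code p) (str_code y) (str_code w)"
    by (rule machine_of_repred[of ?Q, OF Q]) simp_all
  have p: "str_code p = 0 \<longleftrightarrow> p = []" for p
    using str_code_eq_iff[of p "[]"] by simp
  have "prefix_free {p. M p y \<noteq> None}" for y
    by (auto simp: prefix_free_def M(2) p)
  then obtain \<rho> where "\<And>p y. U (\<rho> @ p) y = M p y"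
    using assms M(1) unfolding universal_pf_def pf_machine_def by blast
  moreover have "M [] y = Some x" by (simp add: M(2))
  ultimately have "U (\<rho> @ []) y = Some x" by metis
  then show ?thesis by blast
qed

lemma K_less_iff:
  assumes "universal_pf U"
  shows "K U x < n \<longleftrightarrow> (\<exists>p. length p < n \<and> U p [] = Some x)"
proof
  assume "K U x < n"
  moreover have "\<exists>p. length p = K U x \<and> U p [] = Some x"
    unfolding K_def Kc_def by (rule LeastI_ex) (use universal_pf_surj[OF assms] in blast)
  ultimately show "\<exists>p. length p < n \<and> U p [] = Some x" by metis
next
  assume "\<exists>p. length p < n \<and> U p [] = Some x"
  then obtain p where p: "length p < n" "U p [] = Some x" by blast
  then have "K U x \<le> length p" unfolding K_def Kc_def by (intro Least_le) auto
  with p show "K U x < n" by simp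
qed

section \<open>The matching process\<close>

lemma card_before_less:
  fixes s t :: nat
  assumes "s < t" and "P s"
  shows "card {u. u < s \<and> P u} < card {u. u < t \<and> P u}"
  by (rule psubset_card_mono) (use assms in auto)

lemma card_before_inj:
  fixes s t :: nat
  assumes "P s" and "P t" and "card {u. u < s \<and> P u} = card {u. u < t \<and> P u}"
  shows "s = t"
  using card_before_less[of s t P] card_before_less[of t s P] assms by (metis less_irrefl linorder_neqE_nat)

lemma ex_card_before_eq:
  fixes s :: nat
  assumes "P s" and "n \<le> card {u. u < s \<and> P u}"
  shows "\<exists>t\<le>s. P t \<and> card {u. u < t \<and> P u} = n"
  using assms
proof (induction s rule: less_induct)
  case (less s)
  let ?S = "{u. u < s \<and> P u}"
  show ?case
  proof (cases "card ?S = n")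
    case False
    then have "?S \<noteq> {}" using less.prems by (metis card.empty le_zero_eq)
    then have M: "Max ?S \<in> ?S" by (intro Max_in) auto
    have S: "?S = insert (Max ?S) {u. u < Max ?S \<and> P u}"
    proof
      show "?S \<subseteq> insert (Max ?S) {u. u < Max ?S \<and> P u}"
        using Max_ge[of ?S] by (auto simp: order.order_iff_strict)
    qed (use M in auto)
    have "card ?S = Suc (card {u. u < Max ?S \<and> P u})"
      by (rule trans[OF arg_cong[OF S, of card]]) simp
    then have "\<exists>t\<le>Max ?S. P t \<and> card {u. u < t \<and> P u} = n"
      using less.IH[of "Max ?S"] M False less.prems by simp
    then show ?thesis using M by (auto intro: order_trans less_imp_le)
  qed (use less.prems in auto)
qed

lemma str_code_True_block:
  "str_code (replicate a True @ False # w) + 2 = 2 ^ a * (2 * str_code w + 3)"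
  by (induction a) (auto simp: algebra_simps)

lemma True_block_inj:
  "replicate a True @ False # v = replicate b True @ False # w \<Longrightarrow> a = b \<and> v = w"
proof (induction a arbitrary: b)
  case 0 then show ?case by (cases b) auto
next
  case (Suc a) then show ?case by (cases b) auto
qed

text \<open>Stage \<open>s\<close> matches \<open>L s\<close> with \<open>R s\<close> if \<open>acc s\<close>; \<open>dead s x\<close> says that \<open>x\<close> is known at stage \<open>s\<close>
  to be compressible. The assumptions are symmetric in the two sides, so each conclusion below is
  available for both of them.\<close>

locale matching =
  fixes L R :: "nat \<Rightarrow> nat" and acc :: "nat \<Rightarrow> bool" and dead :: "nat \<Rightarrow> nat \<Rightarrow> bool" and q :: nat
  assumes rfun_L: "rfun L" and rfun_R: "rfun R" and rpred_acc: "rpred acc" and q: "2 \<le> q"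
    and dead_mono: "dead s x \<Longrightarrow> s \<le> t \<Longrightarrow> dead t x"
    and alive_L: "acc s \<Longrightarrow> \<not> dead s (L s)" and alive_R: "acc s \<Longrightarrow> \<not> dead s (R s)"
    and clen_L_R: "acc s \<Longrightarrow> clen (L s) = clen (R s)"
    and dead_R: "acc s \<Longrightarrow> acc t \<Longrightarrow> t < s \<Longrightarrow> L t = L s \<Longrightarrow> dead s (R t)"
    and dead_L: "acc s \<Longrightarrow> acc t \<Longrightarrow> t < s \<Longrightarrow> R t = R s \<Longrightarrow> dead s (L t)"
begin

definition cnt :: "nat \<Rightarrow> nat" where
  "cnt s = card {t. t < s \<and> (acc t \<and> L t = L s)}"

definition exhausting :: "nat \<Rightarrow> bool" where
  "exhausting s \<longleftrightarrow> acc s \<and> cnt s = 2 ^ (2 * (clen (L s) div q))"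

definition rank :: "nat \<Rightarrow> nat" where
  "rank s = card {t. t < s \<and> (exhausting t \<and> clen (L t) div q = clen (L s) div q)}"

lemma rfun_cnt: "rfun cnt"
  unfolding cnt_def[abs_def] by (intro rec_intros rpred_comp[OF rpred_acc] rfun_comp[OF rfun_L])

lemma rpred_exhausting: "rpred exhausting"
  unfolding exhausting_def[abs_def]
  by (intro rec_intros rpred_comp[OF rpred_acc] rfun_comp[OF rfun_L] rfun_comp[OF rfun_cnt])

lemma rfun_rank: "rfun rank"
  unfolding rank_def[abs_def]
  by (intro rec_intros rpred_comp[OF rpred_exhausting] rfun_comp[OF rfun_L])

lemma cnt_inj: "acc s \<Longrightarrow> acc t \<Longrightarrow> L s = L t \<Longrightarrow> cnt s = cnt t \<Longrightarrow> s = t"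
  using card_before_inj[of "\<lambda>u. acc u \<and> L u = L t" s t] by (simp add: cnt_def)

lemma rank_inj:
  assumes "exhausting s" "exhausting t" "clen (L s) div q = clen (L t) div q" "rank s = rank t"
  shows "s = t"
  using card_before_inj[of "\<lambda>u. exhausting u \<and> clen (L u) div q = clen (L t) div q" s t] assms
  by (simp add: rank_def)

lemma Kc_partner_le:
  assumes "universal_pf U"
  shows "\<exists>c. \<forall>s x y. acc s \<and> L s = str_code x \<and> R s = str_code y \<and> cnt s < 2 ^ (2 * (length x div q))
    \<longrightarrow> Kc U y x \<le> 2 * (length x div q) + c"
proof -
  define Q where "Q p y z \<longleftrightarrow> (\<exists>s. clen p = 2 * (clen y div q) \<and> acc s \<and> L s = y \<and> R s = z \<and>
    Suc p = 2 ^ clen p + cnt s)" for p y z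
  have Q: "repred (\<lambda>e. Q (pfst (pfst e)) (psnd (pfst e)) (psnd e))"
    unfolding Q_def by (intro repred_ex repred_rpred rec_intros rpred_comp[OF rpred_acc]
        rfun_comp[OF rfun_L] rfun_comp[OF rfun_R] rfun_comp[OF rfun_cnt])
  have unique: "z = z'" if "Q p y z" "Q p y z'" for p y z z'
    using that cnt_inj unfolding Q_def by (metis add_left_cancel)
  obtain M where M: "partial_computable2 M"
    "\<And>p y w. M p y = Some w \<longleftrightarrow> Q (str_code p) (str_code y) (str_code w)"
    using machine_of_repred[of Q, OF Q] unique by blast
  have len: "length p = 2 * (length y div q)" if "M p y \<noteq> None" for p y
    using that by (auto simp: M(2) Q_def)
  have "prefix_free {p. M p y \<noteq> None}" for y
    unfolding prefix_free_def
  proof (intro ballI impI, elim exE)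
    fix p p' s assume "p \<in> {p. M p y \<noteq> None}" "p' \<in> {p. M p y \<noteq> None}" "p' = p @ s"
    then show "p = p'" using len[of p y] len[of p' y] by simp
  qed
  then obtain c where c: "\<And>p y w. M p y = Some w \<Longrightarrow> Kc U w y \<le> length p + c"
    using universal_pf_simulates[OF assms M(1)] by blast
  have "Kc U y x \<le> 2 * (length x div q) + c"
    if s: "acc s" "L s = str_code x" "R s = str_code y" "cnt s < 2 ^ (2 * (length x div q))" for s x y
  proof -
    obtain p where p: "length p = 2 * (length x div q)" "Suc (str_code p) = 2 ^ (2 * (length x div q)) + cnt s"
      using obtain_string_index[OF s(4)] by blast
    then have "M p x = Some y" unfolding M(2) Q_def using s by (intro exI[of _ s]) simp
    then show ?thesis using c p(1) by fastforce
  qed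
  then show ?thesis by blast
qed

text \<open>A string reaches its \<open>n\<close>-th rematching only after \<open>n\<close> partners died while matched to it, and
  those sets of dead partners are disjoint for different strings.\<close>

lemma rank_less:
  assumes s: "exhausting s" and a: "a = clen (L s) div q"
  shows "rank s < 2 ^ ((q - 2) * a + q)"
proof -
  define F where "F = {t. t \<le> s \<and> exhausting t \<and> clen (L t) div q = a}"
  define G where "G t = {u. u < t \<and> (acc u \<and> L u = L t)}" for t
  have F: "acc t" "card (G t) = 2 ^ (2 * a)" if "t \<in> F" for t
    using that by (auto simp: F_def exhausting_def cnt_def G_def)
  have finF: "finite F" by (simp add: F_def)
  have finG: "finite (G t)" for t by (simp add: G_def)
  have "L t \<noteq> L t'" if "t \<in> F" "t' \<in> F" "t \<noteq> t'" for t t'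
    using that cnt_inj[of t t'] by (auto simp: F_def exhausting_def)
  then have "\<forall>t\<in>F. \<forall>t'\<in>F. t \<noteq> t' \<longrightarrow> G t \<inter> G t' = {}"
    by (force simp: G_def)
  then have "card (\<Union>t\<in>F. G t) = (\<Sum>t\<in>F. card (G t))"
    using finF finG by (intro card_UN_disjoint) auto
  also have "\<dots> = card F * 2 ^ (2 * a)" using F(2) by simp
  finally have card: "card (\<Union>t\<in>F. G t) = card F * 2 ^ (2 * a)" .
  have no: False if "u < u'" "t \<in> F" "u \<in> G t" "acc u'" "R u = R u'" for u u' t
  proof -
    have u: "u < t" "acc u" "L u = L t" and t: "acc t" using that F(1) by (auto simp: G_def)
    have "dead u' (L t)" using dead_L[OF that(4) u(2) that(1,5)] u(3) by simp
    then have "t < u'" using dead_mono[of u' "L t" t] alive_L[OF t] by (meson not_le)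
    moreover have "dead t (R u)" using dead_R[OF t u(2,1,3)] .
    ultimately show False using dead_mono[of t "R u" u'] alive_R[OF that(4)] that(5) by simp
  qed
  have "inj_on R (\<Union>t\<in>F. G t)"
  proof (rule inj_onI)
    fix u u' assume "u \<in> (\<Union>t\<in>F. G t)" "u' \<in> (\<Union>t\<in>F. G t)" "R u = R u'"
    then obtain t t' where "t \<in> F" "u \<in> G t" "t' \<in> F" "u' \<in> G t'" "R u = R u'" by blast
    moreover from this have "acc u" "acc u'" by (auto simp: G_def)
    ultimately show "u = u'" using no by (metis linorder_neqE_nat)
  qed
  moreover have "R ` (\<Union>t\<in>F. G t) \<subseteq> {..<2 ^ (a * q + q)}"
  proof (rule image_subsetI)
    fix u assume "u \<in> (\<Union>t\<in>F. G t)"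
    then have "clen (R u) div q = a" using clen_L_R[of u] by (auto simp: F_def G_def)
    then have "clen (R u) < a * q + q" using dividend_less_div_times[of q "clen (R u)"] q by simp
    then have "(2::nat) ^ Suc (clen (R u)) \<le> 2 ^ (a * q + q)" by (intro power_increasing) auto
    then show "R u \<in> {..<2 ^ (a * q + q)}" using clen_bounds[of "R u"] by simp
  qed
  ultimately have "card F * 2 ^ (2 * a) \<le> 2 ^ (a * q + q)"
    using card_inj_on_le[of R "\<Union>t\<in>F. G t" "{..<2 ^ (a * q + q)}"] card by simp
  also have "a * q + q = ((q - 2) * a + q) + 2 * a"
    using le_Suc_ex[OF q] by (auto simp: algebra_simps)
  finally have F_le: "card F \<le> 2 ^ ((q - 2) * a + q)" by (simp add: power_add)
  have "rank s < card F"
    unfolding rank_def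
  proof (rule psubset_card_mono[OF finF])
    show "{t. t < s \<and> (exhausting t \<and> clen (L t) div q = clen (L s) div q)} \<subset> F"
      using s a by (auto simp: F_def)
  qed
  with F_le show ?thesis by linarith
qed

lemma K_exhausted_le:
  assumes "universal_pf U"
  shows "\<exists>c. \<forall>s x. acc s \<and> L s = str_code x \<and> 2 ^ (2 * (length x div q)) \<le> cnt s
    \<longrightarrow> K U x \<le> (q - 1) * (length x div q) + c"
proof -
  define Q where "Q p y z \<longleftrightarrow> (\<exists>s w. p + 2 = 2 ^ (clen z div q) * (2 * w + 3) \<and>
    clen w = (q - 2) * (clen z div q) + q \<and> exhausting s \<and> L s = z \<and>
    Suc w = 2 ^ clen w + rank s)" for p y z :: nat
  have Q: "repred (\<lambda>e. Q (pfst (pfst e)) (psnd (pfst e)) (psnd e))"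
    unfolding Q_def by (intro repred_ex repred_rpred rec_intros rpred_comp[OF rpred_exhausting]
        rfun_comp[OF rfun_L] rfun_comp[OF rfun_rank])
  have Q_str: "\<exists>s w. p = replicate (clen z div q) True @ False # w \<and>
      length w = (q - 2) * (clen z div q) + q \<and> exhausting s \<and> L s = z \<and>
      Suc (str_code w) = 2 ^ length w + rank s" if pyz: "Q (str_code p) y z" for p y z
  proof -
    obtain s w where w: "str_code p + 2 = 2 ^ (clen z div q) * (2 * w + 3)"
      "clen w = (q - 2) * (clen z div q) + q" "exhausting s" "L s = z" "Suc w = 2 ^ clen w + rank s"
      using pyz unfolding Q_def by blast
    obtain v where v: "w = str_code v" using surj_str_code by metis
    have "str_code p = str_code (replicate (clen z div q) True @ False # v)"
      using w(1) str_code_True_block[of "clen z div q" v] unfolding v[symmetric] by linarith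
    then show ?thesis using w v by (intro exI[of _ s] exI[of _ v]) simp
  qed
  have unique: "z = z'" if z: "Q p y z" "Q p y z'" for p y z z'
  proof -
    obtain p' where p': "p = str_code p'" using surj_str_code by metis
    obtain s w s' w' where w: "p' = replicate (clen z div q) True @ False # w"
        "p' = replicate (clen z' div q) True @ False # w'"
      and s: "exhausting s" "exhausting s'" "L s = z" "L s' = z'"
      and rank: "Suc (str_code w) = 2 ^ length w + rank s" "Suc (str_code w') = 2 ^ length w' + rank s'"
      using Q_str[OF z(1)[unfolded p']] Q_str[OF z(2)[unfolded p']] by blast
    have eq: "clen z div q = clen z' div q \<and> w = w'"
      by (rule True_block_inj) (use w in metis)
    then have "rank s = rank s'" using rank by (metis add_left_cancel)
    then have "s = s'" using rank_inj s eq by metis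
    then show ?thesis using s by simp
  qed
  obtain M where M: "partial_computable2 M"
    "\<And>p y w. M p y = Some w \<longleftrightarrow> Q (str_code p) (str_code y) (str_code w)"
    using machine_of_repred[of Q, OF Q] unique by blast
  have dom: "\<exists>a w. p = replicate a True @ False # w \<and> length w = (q - 2) * a + q"
    if "M p y \<noteq> None" for p y
    using that Q_str M(2) by blast
  have "prefix_free {p. M p y \<noteq> None}" for y
    unfolding prefix_free_def
  proof (intro ballI impI)
    fix p p' assume "p \<in> {p. M p y \<noteq> None}" "p' \<in> {p. M p y \<noteq> None}" "\<exists>s. p' = p @ s"
    then have p: "M p y \<noteq> None" "M p' y \<noteq> None" and "\<exists>s. p' = p @ s" by simp_all
    then obtain s where s: "p' = p @ s" by blast
    obtain a w where w: "p = replicate a True @ False # w" "length w = (q - 2) * a + q"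
      using dom[OF p(1)] by blast
    obtain a' w' where w': "p' = replicate a' True @ False # w'" "length w' = (q - 2) * a' + q"
      using dom[OF p(2)] by blast
    from s w w' have "a = a' \<and> w @ s = w'" using True_block_inj[of a "w @ s" a' w'] by simp
    with s w w' show "p = p'" by auto
  qed
  then obtain c where c: "\<And>p y w. M p y = Some w \<Longrightarrow> Kc U w y \<le> length p + c"
    using universal_pf_simulates[OF assms M(1)] by blast
  have "K U x \<le> (q - 1) * (length x div q) + (Suc q + c)"
    if s: "acc s" "L s = str_code x" "2 ^ (2 * (length x div q)) \<le> cnt s" for s x
  proof -
    define a where "a = length x div q"
    obtain t where t: "acc t" "L t = str_code x" "cnt t = 2 ^ (2 * a)"
    proof -
      have "2 ^ (2 * a) \<le> card {u. u < s \<and> (acc u \<and> L u = str_code x)}"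
        using s by (simp add: cnt_def a_def)
      with ex_card_before_eq[of "\<lambda>u. acc u \<and> L u = str_code x" s "2 ^ (2 * a)"] s
      obtain t where "acc t" "L t = str_code x" "card {u. u < t \<and> (acc u \<and> L u = str_code x)} = 2 ^ (2 * a)"
        by blast
      then show thesis using that[of t] by (simp add: cnt_def)
    qed
    then have ex: "exhausting t" by (simp add: exhausting_def a_def)
    obtain w where w: "length w = (q - 2) * a + q" "Suc (str_code w) = 2 ^ ((q - 2) * a + q) + rank t"
      by (rule obtain_string_index[OF rank_less[OF ex, of a]]) (simp_all add: t a_def)
    let ?p = "replicate a True @ False # w"
    have "M ?p [] = Some x"
      unfolding M(2) Q_def using w t ex str_code_True_block[of a w]
      by (intro exI[of _ t] exI[of _ "str_code w"]) (simp add: a_def)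
    then have "K U x \<le> length ?p + c" using c unfolding K_def by blast
    moreover have "(q - 2) * a + a = (q - 1) * a"
      using le_Suc_ex[OF q] by (auto simp: algebra_simps)
    ultimately show ?thesis using w(1) by (simp add: a_def[symmetric])
  qed
  then show ?thesis by blast
qed

end

definition dead :: "(nat \<Rightarrow> nat \<Rightarrow> bool) \<Rightarrow> nat \<Rightarrow> nat \<Rightarrow> bool" where
  "dead D s x \<longleftrightarrow> (\<exists>t<s. D x t)"

lemma dead_mono: "dead D s x \<Longrightarrow> s \<le> t \<Longrightarrow> dead D t x"
  unfolding dead_def by (meson order_less_le_trans)

definition lft :: "nat \<Rightarrow> nat" where "lft s = pfst (pfst s)"
definition rgt :: "nat \<Rightarrow> nat" where "rgt s = psnd (pfst s)"

text \<open>The second component of a stage is padding: every pair is considered at arbitrarily late stages.\<close>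

fun accepted :: "(nat \<Rightarrow> nat \<Rightarrow> bool) \<Rightarrow> (nat \<Rightarrow> nat \<Rightarrow> bool) \<Rightarrow> nat \<Rightarrow> bool" where
  "accepted T D s \<longleftrightarrow> (\<exists>t<s. T (pfst s) t) \<and> clen (lft s) = clen (rgt s) \<and>
    \<not> dead D s (lft s) \<and> \<not> dead D s (rgt s) \<and>
    (\<forall>t<s. accepted T D t \<longrightarrow>
      (lft t = lft s \<longrightarrow> dead D s (rgt t)) \<and> (rgt t = rgt s \<longrightarrow> dead D s (lft t)))"

declare accepted.simps [simp del]

lemma rfun_lft [rec_intros]: "rfun f \<Longrightarrow> rfun (\<lambda>e. lft (f e))"
  unfolding lft_def by (intro rec_intros)

lemma rfun_rgt [rec_intros]: "rfun f \<Longrightarrow> rfun (\<lambda>e. rgt (f e))"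
  unfolding rgt_def by (intro rec_intros)

lemma rpred_bex2:
  assumes "rpred (\<lambda>e. D (pfst e) (psnd e))" and "rfun f" and "rfun g"
  shows "rpred (\<lambda>e. \<exists>t<f e. D (g e) t)"
proof -
  have "rpred (\<lambda>e. D (g (pfst e)) (psnd e))"
    using rpred_comp[OF assms(1) rfun_pair[OF rfun_comp[OF assms(3) rfun_pfst[OF rfun_id]] rfun_psnd[OF rfun_id]]]
    by simp
  with assms(2) show ?thesis by (intro rec_intros)
qed

lemma odd_set_encode_div: "finite A \<Longrightarrow> odd (set_encode A div 2 ^ t) \<longleftrightarrow> t \<in> A"
  using set_encode_inverse[of A] unfolding set_decode_def by blast

lemma rpred_accepted:
  assumes T: "rpred (\<lambda>e. T (pfst e) (psnd e))" and D: "rpred (\<lambda>e. D (pfst e) (psnd e))"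
  shows "rpred (accepted T D)"
proof (rule rpred_history)
  let ?C = "\<lambda>s b. (\<exists>t<s. T (pfst s) t) \<and> clen (lft s) = clen (rgt s) \<and>
    \<not> dead D s (lft s) \<and> \<not> dead D s (rgt s) \<and>
    (\<forall>t<s. odd (b div 2 ^ t) \<longrightarrow>
      (lft t = lft s \<longrightarrow> dead D s (rgt t)) \<and> (rgt t = rgt s \<longrightarrow> dead D s (lft t)))"
  show "rpred (\<lambda>e. ?C (pfst e) (psnd e))"
    unfolding dead_def
    by (rule rpred_conj rpred_not rpred_imp rpred_ball rpred_bex2[OF T] rpred_bex2[OF D] rpred_odd rpred_eq
        | intro rec_intros)+
  show "accepted T D s \<longleftrightarrow> ?C s (set_encode {t. t < s \<and> accepted T D t})" for s
    by (subst accepted.simps) (simp add: odd_set_encode_div)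
qed

lemma acceptedD:
  assumes "accepted T D s"
  shows "\<exists>t. T (pfst s) t" and "clen (lft s) = clen (rgt s)"
    and "\<not> dead D s (lft s)" and "\<not> dead D s (rgt s)"
    and "t < s \<Longrightarrow> accepted T D t \<Longrightarrow> lft t = lft s \<Longrightarrow> dead D s (rgt t)"
    and "t < s \<Longrightarrow> accepted T D t \<Longrightarrow> rgt t = rgt s \<Longrightarrow> dead D s (lft t)"
  using assms unfolding accepted.simps[of T D s] by blast+

lemma matching_accepted:
  assumes "rpred (\<lambda>e. T (pfst e) (psnd e))" and "rpred (\<lambda>e. D (pfst e) (psnd e))" and "2 \<le> q"
  shows "matching lft rgt (accepted T D) (dead D) q"
proof
  show "rfun lft" "rfun rgt" using rfun_lft[OF rfun_id] rfun_rgt[OF rfun_id] by simp_all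
  show "rpred (accepted T D)" by (rule rpred_accepted[OF assms(1,2)])
qed (fact assms(3) dead_mono | rule acceptedD; assumption)+

lemma matching_accepted_swap:
  assumes "rpred (\<lambda>e. T (pfst e) (psnd e))" and "rpred (\<lambda>e. D (pfst e) (psnd e))" and "2 \<le> q"
  shows "matching rgt lft (accepted T D) (dead D) q"
proof -
  interpret matching lft rgt "accepted T D" "dead D" q by (rule matching_accepted[OF assms])
  show ?thesis
    by unfold_locales (fact rfun_L rfun_R rpred_acc q dead_mono alive_L alive_R clen_L_R[symmetric] dead_L dead_R
        | rule alive_L alive_R clen_L_R[symmetric] dead_L dead_R dead_mono; assumption)+
qed

lemma eventually_all_dead:
  assumes "finite X" and "\<And>v. v \<in> X \<Longrightarrow> \<exists>s. dead D s v"
  shows "\<exists>s. \<forall>v\<in>X. dead D s v"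
  using assms
proof (induction X)
  case (insert v X)
  then obtain s t where "\<forall>v\<in>X. dead D s v" "dead D t v" by (metis insertCI)
  then have "\<forall>w\<in>insert v X. dead D (max s t) w" by (auto intro: dead_mono)
  then show ?case ..
qed auto

lemma ex_surviving_match:
  assumes "T (prod_encode (x, y)) w" and len: "clen x = clen y"
    and x: "\<And>s. \<not> dead D s x" and y: "\<And>s. \<not> dead D s y"
  shows "\<exists>s. accepted T D s \<and> clen (lft s) = clen x \<and> (\<forall>t. \<not> dead D t (lft s) \<and> \<not> dead D t (rgt s))"
proof (rule ccontr)
  assume neg: "\<not> ?thesis"
  let ?X = "rgt ` {t. accepted T D t \<and> lft t = x} \<union> lft ` {t. accepted T D t \<and> rgt t = y}"
  have acc_len: "clen (lft t) = clen (rgt t)" if "accepted T D t" for t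
    using that by (simp add: accepted.simps[of T D t])
  have "?X \<subseteq> {c. clen c \<le> clen x}" using acc_len len by auto
  then have fin: "finite ?X" using finite_clen_le finite_subset by blast
  have ex: "\<exists>s. dead D s v" if "v \<in> ?X" for v
  proof -
    from that obtain t where t: "accepted T D t" "lft t = x \<and> rgt t = v \<or> rgt t = y \<and> lft t = v" by auto
    moreover from this have "clen (lft t) = clen x" using acc_len len by auto
    ultimately show ?thesis using neg x y by blast
  qed
  obtain s0 where s0: "\<forall>v\<in>?X. dead D s0 v"
    using eventually_all_dead[OF fin ex] ..
  define s where "s = prod_encode (prod_encode (x, y), s0 + Suc w)"
  have s: "lft s = x" "rgt s = y" "pfst s = prod_encode (x, y)" by (simp_all add: s_def lft_def rgt_def)
  have "s0 + Suc w \<le> s" unfolding s_def by (rule le_prod_encode_2)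
  then have "s0 \<le> s" "w < s" by auto
  have X: "dead D s v" if "v \<in> ?X" for v
    using s0 that \<open>s0 \<le> s\<close> by (blast intro: dead_mono)
  have "dead D s (rgt t)" if "accepted T D t" "lft t = x" for t
    by (rule X) (use that in blast)
  moreover have "dead D s (lft t)" if "accepted T D t" "rgt t = y" for t
    by (rule X) (use that in blast)
  ultimately have "accepted T D s"
    unfolding accepted.simps[of T D s] s using assms(1) \<open>w < s\<close> len x y by blast
  then show False using neg x y s by blast
qed

lemma infinite_pairs_long:
  fixes X :: "('a::finite list \<times> 'a list) set"
  assumes "infinite X" and "\<And>x y. (x, y) \<in> X \<Longrightarrow> length x = length y"
  shows "\<exists>(x, y)\<in>X. n \<le> length x"
proof (rule ccontr)
  assume "\<not> ?thesis"
  then have "X \<subseteq> {x. length x \<le> n} \<times> {x. length x \<le> n}" using assms(2) by fastforce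
  moreover have "finite {x :: 'a list. length x \<le> n}"
    using finite_lists_length_le[of "UNIV :: 'a set" n] by simp
  ultimately show False using assms(1) finite_subset by blast
qed

theorem mainTheorem10:
  fixes U :: "bool list \<Rightarrow> bool list \<Rightarrow> bool list option"
    and r :: real
  assumes "universal_pf U"
    and "r > 0"
  shows "immune_conditional
           {(x, y). length x = length y \<and> K U x \<ge> length x \<and> K U y \<ge> length y \<and>
                    (real (Kc U x y) \<ge> r * real (length x) \<or>
                     real (Kc U y x) \<ge> r * real (length x))}
           {(x, y). length x = length y \<and> K U x \<ge> length x \<and> K U y \<ge> length y}"
proof -
  let ?R = "{(x, y). length x = length y \<and> K U x \<ge> length x \<and> K U y \<ge> length y}"
  let ?I = "{(x, y). length x = length y \<and> K U x \<ge> length x \<and> K U y \<ge> length y \<and>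
    (real (Kc U x y) \<ge> r * real (length x) \<or> real (Kc U y x) \<ge> r * real (length x))}"
  have False if A: "ce_pairs A" "infinite (A \<inter> ?R)" "A \<inter> ?R \<subseteq> ?I" for A
  proof -
    obtain g where g: "\<And>c. c \<in> pair_code ` A \<longleftrightarrow> (\<exists>y. eval g [c] y)"
      using A(1) unfolding ce_pairs_def ce_def by blast
    have "repred (\<lambda>c. \<exists>y. eval g (list_decode (Suc (prod_encode (c, 0)))) y)"
      by (intro repred_ex repred_eval_comp[OF repred_eval] rec_intros)
    then have "repred (\<lambda>c. c \<in> pair_code ` A)" unfolding g by simp
    then obtain T where T: "rpred (\<lambda>e. T (pfst e) (psnd e))" "\<And>c. c \<in> pair_code ` A \<longleftrightarrow> (\<exists>s. T c s)"
      unfolding repred_def by blast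
    obtain f where f: "\<And>p y z. eval f [str_code p, str_code y] z \<longleftrightarrow> (\<exists>w. U p y = Some w \<and> z = str_code w)"
      using assms(1) unfolding universal_pf_def pf_machine_def partial_computable2_def by blast
    have 1: "repred (\<lambda>x. \<exists>p. clen p < clen x \<and>
        eval f (list_decode (Suc (prod_encode (p, Suc (prod_encode (0, 0)))))) x)"
      by (intro repred_ex repred_conj repred_eval_comp[OF repred_eval] rec_intros)
         (intro repred_rpred rec_intros)
    obtain D where D: "rpred (\<lambda>e. D (pfst e) (psnd e))"
      "\<And>x. (\<exists>p. clen p < clen x \<and> eval f [p, 0] x) \<longleftrightarrow> (\<exists>s. D x s)"
      using 1 unfolding repred_def by (auto simp del: list_decode.simps(2))
    have D_K: "(\<exists>s. dead D s (str_code x)) \<longleftrightarrow> K U x < length x" for x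
    proof -
      have "(\<exists>s. dead D s (str_code x)) \<longleftrightarrow> (\<exists>s. D (str_code x) s)" unfolding dead_def by blast
      also have "\<dots> \<longleftrightarrow> (\<exists>p. clen p < length x \<and> eval f [p, str_code []] (str_code x))"
        unfolding D(2)[symmetric] by simp
      also have "\<dots> \<longleftrightarrow> (\<exists>p. length p < length x \<and> eval f [str_code p, str_code []] (str_code x))"
        by (metis clen_str_code surj_str_code)
      also have "\<dots> \<longleftrightarrow> K U x < length x"
        unfolding f K_less_iff[OF assms(1)] by simp
      finally show ?thesis .
    qed
    obtain q0 :: nat where q0: "4 / r < real q0" using reals_Archimedean2 by blast
    define q where "q = max 2 q0"
    have q: "2 \<le> q" "4 / r < real q" using q0 by (auto simp: q_def)
    interpret left: matching lft rgt "accepted T D" "dead D" q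
      by (rule matching_accepted[OF T(1) D(1) q(1)])
    interpret right: matching rgt lft "accepted T D" "dead D" q
      by (rule matching_accepted_swap[OF T(1) D(1) q(1)])
    obtain c1 where c1: "\<And>s x y. accepted T D s \<Longrightarrow> lft s = str_code x \<Longrightarrow> rgt s = str_code y \<Longrightarrow>
        left.cnt s < 2 ^ (2 * (length x div q)) \<Longrightarrow> Kc U y x \<le> 2 * (length x div q) + c1"
      using left.Kc_partner_le[OF assms(1)] by blast
    obtain c2 where c2: "\<And>s x y. accepted T D s \<Longrightarrow> rgt s = str_code x \<Longrightarrow> lft s = str_code y \<Longrightarrow>
        right.cnt s < 2 ^ (2 * (length x div q)) \<Longrightarrow> Kc U y x \<le> 2 * (length x div q) + c2"
      using right.Kc_partner_le[OF assms(1)] by blast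
    obtain c3 where c3: "\<And>s x. accepted T D s \<Longrightarrow> lft s = str_code x \<Longrightarrow>
        2 ^ (2 * (length x div q)) \<le> left.cnt s \<Longrightarrow> K U x \<le> (q - 1) * (length x div q) + c3"
      using left.K_exhausted_le[OF assms(1)] by blast
    obtain c4 where c4: "\<And>s x. accepted T D s \<Longrightarrow> rgt s = str_code x \<Longrightarrow>
        2 ^ (2 * (length x div q)) \<le> right.cnt s \<Longrightarrow> K U x \<le> (q - 1) * (length x div q) + c4"
      using right.K_exhausted_le[OF assms(1)] by blast
    define c where "c = max (max c1 c2) (max c3 c4)"
    obtain n0 :: nat where n0: "2 * real c / r < real n0" using reals_Archimedean2 by blast
    obtain x y where xy: "(x, y) \<in> A \<inter> ?R" "max n0 (q * Suc c) \<le> length x"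
    proof -
      have "length x = length y" if "(x, y) \<in> A \<inter> ?R" for x y using that by simp
      from infinite_pairs_long[OF A(2) this] show thesis using that by blast
    qed
    define n where "n = length x"
    obtain w where w: "T (pair_code (x, y)) w" using xy(1) T(2) by blast
    have "\<exists>s. accepted T D s \<and> clen (lft s) = clen (str_code x) \<and>
        (\<forall>t. \<not> dead D t (lft s) \<and> \<not> dead D t (rgt s))"
    proof (rule ex_surviving_match)
      show "T (prod_encode (str_code x, str_code y)) w" using w by (simp add: pair_code_def)
      show "\<not> dead D s (str_code x)" "\<not> dead D s (str_code y)" for s
        using D_K[of x] D_K[of y] xy(1) by auto
    qed (use xy(1) in simp)
    then obtain s where s: "accepted T D s" "clen (lft s) = n"
      "\<And>t. \<not> dead D t (lft s)" "\<And>t. \<not> dead D t (rgt s)" by (auto simp: n_def)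
    obtain x' y' where x': "lft s = str_code x'" and y': "rgt s = str_code y'"
      using surj_str_code by metis
    have len: "length x' = n" "length y' = n" using s(2) acceptedD(2)[OF s(1)] x' y' by simp_all
    have K: "n \<le> K U x'" "n \<le> K U y'"
      using D_K[of x'] D_K[of y'] s(3,4) len by (auto simp: x' y' not_less)
    have "pfst s = pair_code (x', y')"
      by (simp add: pair_code_def flip: x' y') (simp add: lft_def rgt_def)
    then have "pair_code (x', y') \<in> pair_code ` A" using acceptedD(1)[OF s(1)] T(2) by metis
    then have "(x', y') \<in> A" by (auto simp: pair_code_def)
    then have "(x', y') \<in> ?I" using A(3) K len by auto
    then have big: "r * real n \<le> real (Kc U x' y') \<or> r * real n \<le> real (Kc U y' x')"
      using len by auto
    have n: "n0 \<le> n" "q * Suc c \<le> n" using xy(2) by (simp_all add: n_def)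
    have "c < n div q"
      using n(2) q(1) less_eq_div_iff_mult_less_eq[of q "Suc c" n] by (simp add: mult.commute)
    then have "(q - 1) * (n div q) + c < (q - 1) * (n div q) + n div q" by simp
    also have "\<dots> = q * (n div q)" using q(1) by (cases q) auto
    also have "\<dots> \<le> n" by simp
    finally have small: "(q - 1) * (n div q) + c < n" .
    have "left.cnt s < 2 ^ (2 * (n div q))"
    proof (rule ccontr)
      assume "\<not> ?thesis"
      then have "K U x' \<le> (q - 1) * (n div q) + c3" using c3[OF s(1) x'] len by simp
      with small K(1) show False by (simp add: c_def)
    qed
    then have k1: "Kc U y' x' \<le> 2 * (n div q) + c"
      using c1[OF s(1) x' y'] len by (simp add: c_def)
    have "right.cnt s < 2 ^ (2 * (n div q))"
    proof (rule ccontr)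
      assume "\<not> ?thesis"
      then have "K U y' \<le> (q - 1) * (n div q) + c4" using c4[OF s(1) y'] len by simp
      with small K(2) show False by (simp add: c_def)
    qed
    then have k2: "Kc U x' y' \<le> 2 * (n div q) + c"
      using c2[OF s(1) y' x'] len by (simp add: c_def)
    have "4 * real (n div q) \<le> (r * real q) * real (n div q)"
      using q(2) assms(2) by (intro mult_right_mono) (auto simp: field_simps)
    also have "\<dots> = r * real (q * (n div q))" by simp
    also have "\<dots> \<le> r * real n"
      using assms(2) by (intro mult_left_mono of_nat_mono) auto
    finally have "4 * real (n div q) \<le> r * real n" .
    moreover have "2 * real c < r * real n"
    proof -
      have "2 * real c < r * real n0" using n0 assms(2) by (simp add: field_simps)
      also have "\<dots> \<le> r * real n" using n(1) assms(2) by (intro mult_left_mono) auto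
      finally show ?thesis .
    qed
    ultimately have "real (2 * (n div q) + c) < r * real n" by simp
    with k1 k2 big show False by linarith
  qed
  then show ?thesis unfolding immune_conditional_def by blast
qed

end
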